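(* Let $A$ be an $n\times n$ matrix with entries in the quaternions $\mathbb{H}$, with quaternionic numerical range $W=W(A)=\{\boldsymbol{x}^*A\boldsymbol{x}:\boldsymbol{x}\in\mathbb{H}^n,\ |\boldsymbol{x}|=1\}$. Then $W$ is star-shaped, and $W\cap\mathbb{R}\subseteq\mathcal{C}(W)$, where $\mathcal{C}(W)$ denotes the star-center of $W$.
   Context: $\mathbb{H}$ is the real algebra of Hamilton quaternions with basis $1,i,j,k$; $\boldsymbol{x}^*$ denotes the conjugate transpose of $\boldsymbol{x}\in\mathbb{H}^n$ and $|\boldsymbol{x}|^2=\boldsymbol{x}^*\boldsymbol{x}$. For elements $b_0,b$ of a real vector space, $[b_0,b]=\{(1-\alpha)b_0+\alpha b:\alpha\in[0,1]\}$. A subset $B$ of a real vector space (here $\mathbb{H}\cong\mathbb{R}^4$) is star-shaped if there is $b_0\in B$ with $[b_0,b]\subseteq B$ for all $b\in B$. The star-center of $B$ is $\mathcal{C}(B)=\{b_0\in B: [b_0,b]\subseteq B \text{ for all } b\in B\}$.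
   Formalization: That W is star-shaped is asserted only for n ≥ 2, since for n = 1 and A = [i] the set W is the unit sphere of pure quaternions, which is not star-shaped; the inclusion of W ∩ ℝ in the star-center is proved for every n ≥ 1. *)

theory Defs
  imports "HOL-Analysis.Analysis"
begin

section \<open>The quaternions as a real normed division algebra\<close>

datatype quat = Quat (q0: real) (q1: real) (q2: real) (q3: real)

lemma quat_eq_iff:
  "x = y \<longleftrightarrow> q0 x = q0 y \<and> q1 x = q1 y \<and> q2 x = q2 y \<and> q3 x = q3 y"
  by (auto intro: quat.expand)

instantiation quat :: "{zero, one, plus, minus, uminus, times, scaleR, inverse}"
begin

definition "0 = Quat 0 0 0 0"

definition "1 = Quat 1 0 0 0"

definition "x + y = Quat (q0 x + q0 y) (q1 x + q1 y) (q2 x + q2 y) (q3 x + q3 y)"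

definition "x - y = Quat (q0 x - q0 y) (q1 x - q1 y) (q2 x - q2 y) (q3 x - q3 y)"

definition "- x = Quat (- q0 x) (- q1 x) (- q2 x) (- q3 x)"

definition "r *\<^sub>R x = Quat (r * q0 x) (r * q1 x) (r * q2 x) (r * q3 x)"

definition times_quat_def:
  "x * y = Quat
    (q0 x * q0 y - q1 x * q1 y - q2 x * q2 y - q3 x * q3 y)
    (q0 x * q1 y + q1 x * q0 y + q2 x * q3 y - q3 x * q2 y)
    (q0 x * q2 y - q1 x * q3 y + q2 x * q0 y + q3 x * q1 y)
    (q0 x * q3 y + q1 x * q2 y - q2 x * q1 y + q3 x * q0 y)"

definition inverse_quat_def:
  "inverse x = (let s = (q0 x)\<^sup>2 + (q1 x)\<^sup>2 + (q2 x)\<^sup>2 + (q3 x)\<^sup>2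
    in Quat (q0 x / s) (- q1 x / s) (- q2 x / s) (- q3 x / s))"

definition divide_quat_def: "x div (y :: quat) = x * inverse y"

instance ..

end

lemmas quat_arith_defs = zero_quat_def one_quat_def plus_quat_def minus_quat_def
  uminus_quat_def scaleR_quat_def times_quat_def

lemma quat_sel [simp]:
  "q0 0 = 0" "q1 0 = 0" "q2 0 = 0" "q3 0 = 0"
  "q0 1 = 1" "q1 1 = 0" "q2 1 = 0" "q3 1 = 0"
  "q0 (x + y) = q0 x + q0 y" "q1 (x + y) = q1 x + q1 y"
  "q2 (x + y) = q2 x + q2 y" "q3 (x + y) = q3 x + q3 y"
  "q0 (x - y) = q0 x - q0 y" "q1 (x - y) = q1 x - q1 y"
  "q2 (x - y) = q2 x - q2 y" "q3 (x - y) = q3 x - q3 y"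
  "q0 (- x) = - q0 x" "q1 (- x) = - q1 x" "q2 (- x) = - q2 x" "q3 (- x) = - q3 x"
  "q0 (r *\<^sub>R x) = r * q0 x" "q1 (r *\<^sub>R x) = r * q1 x"
  "q2 (r *\<^sub>R x) = r * q2 x" "q3 (r *\<^sub>R x) = r * q3 x"
  by (simp_all add: quat_arith_defs)

lemma quat_sel_times:
  "q0 (x * y) = q0 x * q0 y - q1 x * q1 y - q2 x * q2 y - q3 x * q3 y"
  "q1 (x * y) = q0 x * q1 y + q1 x * q0 y + q2 x * q3 y - q3 x * q2 y"
  "q2 (x * y) = q0 x * q2 y - q1 x * q3 y + q2 x * q0 y + q3 x * q1 y"
  "q3 (x * y) = q0 x * q3 y + q1 x * q2 y - q2 x * q1 y + q3 x * q0 y"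
  by (simp_all add: times_quat_def)

lemma quat_sum_squares_eq_0_iff:
  "(q0 x)\<^sup>2 + (q1 x)\<^sup>2 + (q2 x)\<^sup>2 + (q3 x)\<^sup>2 = 0 \<longleftrightarrow> x = 0"
  by (simp add: quat_eq_iff add_nonneg_eq_0_iff)

instance quat :: real_algebra_1
  by standard (simp_all add: quat_eq_iff quat_sel_times algebra_simps)

instance quat :: real_div_algebra
proof
  fix x y :: quat
  show "inverse x * x = 1" and "x * inverse x = 1" if "x \<noteq> 0"
  proof -
    define s where "s = (q0 x)\<^sup>2 + (q1 x)\<^sup>2 + (q2 x)\<^sup>2 + (q3 x)\<^sup>2"
    have "s \<noteq> 0"
      using that by (simp add: s_def quat_sum_squares_eq_0_iff)
    moreover have inv: "inverse x = Quat (q0 x / s) (- q1 x / s) (- q2 x / s) (- q3 x / s)"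
      by (simp add: inverse_quat_def s_def Let_def)
    ultimately show "inverse x * x = 1" "x * inverse x = 1"
      by (simp_all add: quat_eq_iff quat_sel_times inv field_simps)
         (simp_all add: s_def power2_eq_square)
  qed
  show "x div y = x * inverse y"
    by (rule divide_quat_def)
  show "inverse 0 = (0 :: quat)"
    by (simp add: inverse_quat_def zero_quat_def)
qed

instantiation quat :: real_inner
begin

definition inner_quat_def:
  "x \<bullet> y = q0 x * q0 y + q1 x * q1 y + q2 x * q2 y + q3 x * q3 y"

definition norm_quat_def: "norm (x :: quat) = sqrt (x \<bullet> x)"

definition sgn_quat_def: "sgn (x :: quat) = x /\<^sub>R norm x"

definition dist_quat_def: "dist (x :: quat) y = norm (x - y)"

definition uniformity_quat_def [code del]:
  "(uniformity :: (quat \<times> quat) filter) = (INF e\<in>{0 <..}. principal {(x, y). dist x y < e})"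

definition open_quat_def [code del]:
  "open (U :: quat set) \<longleftrightarrow> (\<forall>x\<in>U. eventually (\<lambda>(x', y). x' = x \<longrightarrow> y \<in> U) uniformity)"

instance
proof
  fix x y z :: quat and r :: real
  show "x \<bullet> y = y \<bullet> x" "(x + y) \<bullet> z = x \<bullet> z + y \<bullet> z" "(r *\<^sub>R x) \<bullet> y = r * (x \<bullet> y)"
    by (simp_all add: inner_quat_def algebra_simps)
  show "0 \<le> x \<bullet> x"
    by (simp add: inner_quat_def)
  show "x \<bullet> x = 0 \<longleftrightarrow> x = 0"
    using quat_sum_squares_eq_0_iff[of x] by (simp add: inner_quat_def power2_eq_square)
qed (rule norm_quat_def sgn_quat_def dist_quat_def uniformity_quat_def open_quat_def)+

end

instance quat :: real_normed_div_algebra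
proof
  fix x y :: quat
  show "norm (x * y) = norm x * norm y"
    unfolding norm_quat_def real_sqrt_mult[symmetric]
    by (simp add: inner_quat_def quat_sel_times algebra_simps)
qed

instantiation quat :: euclidean_space
begin

definition Basis_quat_def: "Basis = {1, Quat 0 1 0 0, Quat 0 0 1 0, Quat 0 0 0 1}"

instance
proof
  show "(Basis :: quat set) \<noteq> {}" "finite (Basis :: quat set)"
    by (simp_all add: Basis_quat_def)
next
  fix u v :: quat assume "u \<in> Basis" "v \<in> Basis"
  then show "u \<bullet> v = (if u = v then 1 else 0)"
    unfolding Basis_quat_def by (elim insertE emptyE) (simp_all add: inner_quat_def quat_eq_iff)
next
  fix x :: quat
  show "(\<forall>u\<in>Basis. x \<bullet> u = 0) \<longleftrightarrow> x = 0"
    by (simp add: Basis_quat_def inner_quat_def quat_eq_iff[of x 0])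
qed

end

lemma quat_units_mult:
  defines "qi \<equiv> Quat 0 1 0 0" and "qj \<equiv> Quat 0 0 1 0" and "qk \<equiv> Quat 0 0 0 1"
  shows "qi * qi = -1" "qj * qj = -1" "qk * qk = -1" "qi * qj * qk = -1"
  by (simp_all add: qi_def qj_def qk_def quat_eq_iff quat_sel_times)

definition qcnj :: "quat \<Rightarrow> quat" where
  "qcnj x = Quat (q0 x) (- q1 x) (- q2 x) (- q3 x)"

section \<open>The numerical range and the star-center\<close>

text \<open>\<open>qdot x y\<close> is the product \<open>x\<^sup>* y\<close> of a conjugate transpose with a column vector.
  The order of the factors matters.\<close>

definition qdot :: "quat ^ 'n \<Rightarrow> quat ^ 'n \<Rightarrow> quat" where
  "qdot x y = (\<Sum>i\<in>UNIV. qcnj (x $ i) * y $ i)"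

text \<open>The library norm on \<open>quat ^ 'n\<close> is the one given by \<open>|x|\<^sup>2 = x\<^sup>* x\<close>.\<close>

lemma qdot_self: "qdot x x = of_real ((norm x)\<^sup>2)"
proof -
  have "qcnj a * a = of_real ((norm a)\<^sup>2)" for a
    by (simp add: quat_eq_iff quat_sel_times qcnj_def of_real_def norm_quat_def inner_quat_def)
  then show ?thesis
    by (simp add: qdot_def norm_vec_def L2_set_def sum_nonneg)
qed

definition qnum_range :: "quat ^ 'n ^ 'n \<Rightarrow> quat set" where
  "qnum_range A = {qdot x (A *v x) | x. norm x = 1}"

definition star_center :: "'a :: real_vector set \<Rightarrow> 'a set" where
  "star_center B = {b0 \<in> B. \<forall>b\<in>B. closed_segment b0 b \<subseteq> B}"

lemma starlike_iff_star_center: "starlike B \<longleftrightarrow> star_center B \<noteq> {}"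
  by (auto simp: starlike_def star_center_def)

text \<open>Star-shapedness needs \<open>n \<ge> 2\<close>: for \<open>n = 1\<close> and a non-real entry the numerical range
  is a sphere.\<close>

lemma not_starlike_qnum_range_1:
  fixes A :: "quat ^ 1 ^ 1"
  assumes A: "A = mat (Quat 0 1 0 0)"
  shows "\<not> starlike (qnum_range A)"
proof
  have W: "qnum_range A = {qcnj (x $ 1) * (Quat 0 1 0 0 * x $ 1) | x :: quat ^ 1. norm x = 1}"
    by (simp add: qnum_range_def qdot_def A mat_def matrix_vector_mult_def)
  have norm1: "norm w = 1" if "w \<in> qnum_range A" for w
  proof -
    obtain x :: "quat ^ 1" where x: "norm x = 1" "w = qcnj (x $ 1) * (Quat 0 1 0 0 * x $ 1)"
      using \<open>w \<in> qnum_range A\<close> unfolding W by blast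
    have "norm (x $ 1) = 1" "norm (qcnj (x $ 1)) = norm (x $ 1)"
      using x by (simp_all add: norm_vec_def norm_quat_def inner_quat_def qcnj_def)
    then show ?thesis
      unfolding x(2) by (simp add: norm_mult) (simp add: norm_quat_def inner_quat_def)
  qed
  have uminus_closed: "- w \<in> qnum_range A" if "w \<in> qnum_range A" for w
  proof -
    obtain x :: "quat ^ 1" where x: "norm x = 1" "w = qcnj (x $ 1) * (Quat 0 1 0 0 * x $ 1)"
      using \<open>w \<in> qnum_range A\<close> unfolding W by blast
    define y :: "quat ^ 1" where "y = (\<chi> i. Quat 0 0 1 0 * x $ 1)"
    have "norm y = norm x"
      by (simp add: y_def norm_vec_def norm_mult) (simp add: norm_quat_def inner_quat_def)
    moreover have "- w = qcnj (y $ 1) * (Quat 0 1 0 0 * y $ 1)"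
      by (simp add: x(2) y_def quat_eq_iff quat_sel_times qcnj_def algebra_simps)
    ultimately show ?thesis
      unfolding W using x(1) by auto
  qed
  assume "starlike (qnum_range A)"
  then obtain a where a: "a \<in> qnum_range A" "\<And>x. x \<in> qnum_range A \<Longrightarrow> closed_segment a x \<subseteq> qnum_range A"
    by (auto simp: starlike_def)
  have "0 \<in> closed_segment a (- a)"
    unfolding closed_segment_def by (rule CollectI, rule exI[of _ "1/2"]) (simp add: quat_eq_iff)
  then have "0 \<in> qnum_range A"
    using a uminus_closed by blast
  then show False
    using norm1[of 0] by simp
qed

end

theory Submission
  imports Defs
begin

text \<open>
  The form \<open>(x, y) \<mapsto> x\<^sup>* A y\<close> is additive in both arguments and satisfies
  \<open>(x p)\<^sup>* A (y q) = p\<^sup>* (x\<^sup>* A y) q\<close>, where vectors are multiplied by scalars on the right.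
  Both halves of the theorem are statements about such sesquilinear forms \<open>F\<close>, and both
  come from restricting \<open>F\<close> to the span of two vectors.

  \<^emph>\<open>Real points are star centers.\<close> Let \<open>a = x\<^sup>* A x\<close> be real and \<open>b = y\<^sup>* A y\<close> with
  \<open>|x| = |y| = 1\<close> and \<open>b \<noteq> a\<close>. Subtracting \<open>a x\<^sup>* y\<close> from the form (which is again
  sesquilinear because \<open>a\<close> is central) moves \<open>a\<close> to \<open>0\<close>, so that \<open>x\<close> becomes isotropic.
  For a scalar \<open>p\<close>, the shifted form \<open>F\<close> takes on \<open>(1 - t) x p + t y\<close> the value
  \<open>t (1 - t) (F (x p) y + F y (x p)) + t\<^sup>2 (b - a)\<close>. The mixed term depends on \<open>p\<close> in a
  real-linear way, and a real-linear map between spaces of dimension \<open>4\<close> sends some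
  \<open>p \<noteq> 0\<close> into the line through \<open>b - a\<close> (\<open>real_linear_hits_line\<close>). For this \<open>p\<close> the whole
  path stays on that line, and after normalization it sweeps out the segment
  by the intermediate value theorem (\<open>isotropic_segment\<close>).

  \<^emph>\<open>For \<open>n \<ge> 2\<close> there are real points.\<close> The value \<open>x\<^sup>* A x\<close> is real iff \<open>x\<close> is isotropic
  for the skew-Hermitian form \<open>K x y = x\<^sup>* A y - (y\<^sup>* A x)\<^sup>*\<close>. On a two-dimensional subspace
  with a basis vector that is not already isotropic, a Gram-Schmidt step diagonalizes \<open>K\<close>, with
  purely imaginary diagonal entries \<open>\<alpha> \<noteq> 0\<close> and \<open>\<beta>\<close>. If \<open>\<beta> = 0\<close>, an isotropic vector has been
  found. Otherwise, since all imaginary quaternions of the same length are conjugate, \<open>\<beta>\<close> can be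
  rotated onto a negative multiple of \<open>\<alpha>\<close>, and then the two entries cancel on a suitable
  combination (\<open>skew_hermitian_isotropic\<close>).
\<close>

section \<open>Conjugation and imaginary quaternions\<close>

lemma qcnj_simps [simp]:
  "qcnj 0 = 0" "qcnj 1 = 1" "qcnj (qcnj x) = x" "qcnj (of_real r) = of_real r"
  by (simp_all add: qcnj_def quat_eq_iff of_real_def)

lemma qcnj_add: "qcnj (x + y) = qcnj x + qcnj y"
  and qcnj_diff: "qcnj (x - y) = qcnj x - qcnj y"
  and qcnj_scaleR: "qcnj (r *\<^sub>R x) = r *\<^sub>R qcnj x"
  and qcnj_mult: "qcnj (x * y) = qcnj y * qcnj x"
  by (simp_all add: qcnj_def quat_eq_iff quat_sel_times)

lemma qcnj_mult_self: "qcnj x * x = of_real ((norm x)\<^sup>2)"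
  by (simp add: quat_eq_iff quat_sel_times qcnj_def of_real_def norm_quat_def inner_quat_def)

lemma qcnj_eq_self_imp_Reals: "x \<in> \<real>" if "qcnj x = x"
proof -
  have "x = of_real (q0 x)"
    using that by (simp add: qcnj_def quat_eq_iff of_real_def)
  then show ?thesis
    by (metis Reals_of_real)
qed

lemma imaginary_square: "x * x = - of_real ((norm x)\<^sup>2)" if "qcnj x = - x"
  using qcnj_mult_self[of x] that by (metis add.inverse_inverse mult_minus_left)

text \<open>The element \<open>u = \<beta> w - w \<alpha>\<close> satisfies \<open>\<beta> u + u \<alpha> = \<beta>\<^sup>2 w - w \<alpha>\<^sup>2\<close>, and this vanishes
  because \<open>\<alpha>\<^sup>2\<close> and \<open>\<beta>\<^sup>2\<close> are the same real number. If \<open>u\<close> were zero for all of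
  \<open>w = 1, i, j\<close>, then \<open>\<alpha> = \<beta>\<close> would be central, hence real as well as imaginary.\<close>

lemma imaginary_conjugate_opposite:
  fixes \<alpha> \<beta> :: quat
  assumes im: "qcnj \<alpha> = - \<alpha>" "qcnj \<beta> = - \<beta>" and norms: "norm \<alpha> = norm \<beta>" and "\<alpha> \<noteq> 0"
  obtains u where "u \<noteq> 0" "\<beta> * u = - (u * \<alpha>)"
proof -
  have "\<exists>w. \<beta> * w - w * \<alpha> \<noteq> 0"
  proof (rule ccontr)
    assume "\<not> ?thesis"
    then have comm: "\<beta> * w = w * \<alpha>" for w
      by simp
    have "\<alpha> = 0"
      using comm[of 1] comm[of "Quat 0 1 0 0"] comm[of "Quat 0 0 1 0"] im(1)
      by (simp add: quat_eq_iff quat_sel_times qcnj_def)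
    with \<open>\<alpha> \<noteq> 0\<close> show False ..
  qed
  then obtain w where w: "\<beta> * w - w * \<alpha> \<noteq> 0" ..
  have "\<beta> * (\<beta> * w - w * \<alpha>) + (\<beta> * w - w * \<alpha>) * \<alpha> = (\<beta> * \<beta>) * w - w * (\<alpha> * \<alpha>)"
    by (simp add: algebra_simps)
  also have "\<dots> = 0"
    unfolding imaginary_square[OF im(1)] imaginary_square[OF im(2)] norms
    by (simp add: of_real_def)
  finally have "\<beta> * (\<beta> * w - w * \<alpha>) = - ((\<beta> * w - w * \<alpha>) * \<alpha>)"
    by (simp add: eq_neg_iff_add_eq_0)
  with w show ?thesis
    by (rule that)
qed

section \<open>Sesquilinear forms over the quaternions\<close>

definition right_scale :: "quat ^ 'n \<Rightarrow> quat \<Rightarrow> quat ^ 'n" (infixl "*r" 70) where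
  "x *r p = (\<chi> i. x $ i * p)"

lemma right_scale_nth [simp]: "(x *r p) $ i = x $ i * p"
  by (simp add: right_scale_def)

lemma right_scale_of_real: "x *r of_real t = t *\<^sub>R x"
  by (simp add: vec_eq_iff of_real_def)

lemma right_scale_assoc: "x *r p *r q = x *r (p * q)"
  by (simp add: vec_eq_iff mult.assoc)

lemma right_scale_eq_0_iff: "x *r p = 0 \<longleftrightarrow> x = 0 \<or> p = 0"
  by (auto simp: vec_eq_iff)

lemma matrix_vector_mult_right_scale: "A *v (x *r p) = (A *v x) *r p" for A :: "quat ^ 'n ^ 'm"
  by (simp add: vec_eq_iff matrix_vector_mult_def sum_distrib_right mult.assoc)

locale sesquilinear =
  fixes F :: "quat ^ 'n \<Rightarrow> quat ^ 'n \<Rightarrow> quat"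
  assumes add_left: "F (x + y) z = F x z + F y z"
    and add_right: "F x (y + z) = F x y + F x z"
    and scale_left: "F (x *r p) y = qcnj p * F x y"
    and scale_right: "F x (y *r p) = F x y * p"
begin

lemma scaleR_left: "F (t *\<^sub>R x) y = t *\<^sub>R F x y"
  using scale_left[of x "of_real t" y] by (simp add: right_scale_of_real scaleR_conv_of_real)

lemma scaleR_right: "F x (t *\<^sub>R y) = t *\<^sub>R F x y"
  using scale_right[of x y "of_real t"]
  by (simp add: right_scale_of_real) (simp add: of_real_def)

lemma combination:
  "F (x *r p + y *r q) (x *r p + y *r q) =
    qcnj p * F x x * p + qcnj p * F x y * q + qcnj q * F y x * p + qcnj q * F y y * q"
  by (simp add: add_left add_right scale_left scale_right algebra_simps)

end

lemma sesquilinear_qdot: "sesquilinear qdot"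
  by standard (simp_all add: qdot_def qcnj_add qcnj_mult algebra_simps sum.distrib
      sum_distrib_left sum_distrib_right)

lemma sesquilinear_matrix: "sesquilinear (\<lambda>x y. qdot x (A *v y))"
proof -
  interpret sesquilinear qdot
    by (rule sesquilinear_qdot)
  show ?thesis
    by standard (simp_all add: add_left add_right scale_left scale_right
        matrix_vector_right_distrib matrix_vector_mult_right_scale)
qed

text \<open>Here \<open>a\<close> must be real: only central multiples of a sesquilinear form are sesquilinear.\<close>

lemma sesquilinear_diff_real_multiple:
  assumes "sesquilinear F" "sesquilinear G"
  shows "sesquilinear (\<lambda>x y. F x y - a *\<^sub>R G x y)"
proof -
  interpret F: sesquilinear F by fact
  interpret G: sesquilinear G by fact
  show ?thesis
    by standard (simp_all add: F.add_left F.add_right F.scale_left F.scale_right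
        G.add_left G.add_right G.scale_left G.scale_right algebra_simps)
qed

lemma sesquilinear_skew_part:
  assumes "sesquilinear F"
  shows "sesquilinear (\<lambda>x y. F x y - qcnj (F y x))"
proof -
  interpret sesquilinear F by fact
  show ?thesis
    by standard (simp_all add: add_left add_right scale_left scale_right qcnj_add qcnj_mult
        algebra_simps)
qed

section \<open>Isotropic vectors of skew-Hermitian forms\<close>

text \<open>The vector \<open>z\<close> in the proof is \<open>y\<close> made orthogonal to \<open>x\<close>, which is possible as soon
  as \<open>K x x \<noteq> 0\<close>. If neither \<open>x\<close> nor \<open>z\<close> is isotropic, \<open>\<alpha> = K x x\<close> and \<open>\<beta> = K z z\<close> are
  nonzero imaginary quaternions, and they are made to cancel after a rotation of \<open>\<beta>\<close>.
  Independence of \<open>x\<close> and \<open>y\<close> keeps the resulting combination from being the zero vector.\<close>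

lemma skew_hermitian_isotropic:
  fixes K :: "quat ^ 'n \<Rightarrow> quat ^ 'n \<Rightarrow> quat" and x y :: "quat ^ 'n"
  assumes "sesquilinear K" and skew: "\<And>v w. qcnj (K v w) = - K w v"
    and "x \<noteq> 0" and indep: "\<And>p. y \<noteq> x *r p"
  shows "\<exists>v. v \<noteq> 0 \<and> K v v = 0"
proof -
  interpret sesquilinear K by fact
  define \<alpha> where "\<alpha> = K x x"
  define g where "g = - (inverse \<alpha> * K x y)"
  define z where "z = y + x *r g"
  define \<beta> where "\<beta> = K z z"
  have z_indep: "z *r u + x *r p \<noteq> 0" if "u \<noteq> 0" for u p
  proof
    assume eq: "z *r u + x *r p = 0"
    have "y = x *r (- (p * inverse u) - g)"
    proof (rule vec_eq_iff[THEN iffD2, rule_format])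
      fix i
      have "(y $ i + x $ i * g) * u + x $ i * p = 0"
        using arg_cong[OF eq, of "\<lambda>v. v $ i"] by (simp add: z_def)
      then have "(y $ i + x $ i * g) * u = - (x $ i * p)"
        by (simp only: eq_neg_iff_add_eq_0)
      then have "(y $ i + x $ i * g) * u * inverse u = - (x $ i * p) * inverse u"
        by (rule arg_cong)
      then have "y $ i + x $ i * g = - (x $ i * p) * inverse u"
        using that by (simp add: mult.assoc)
      then show "y $ i = (x *r (- (p * inverse u) - g)) $ i"
        by (simp add: algebra_simps eq_diff_eq)
    qed
    then show False
      using indep by blast
  qed
  consider "\<alpha> = 0" | "\<beta> = 0" | "\<alpha> \<noteq> 0" "\<beta> \<noteq> 0"
    by blast
  then show ?thesis
  proof cases
    case 1
    then show ?thesis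
      using \<open>x \<noteq> 0\<close> by (auto simp: \<alpha>_def)
  next
    case 2
    have "z \<noteq> 0"
      using z_indep[of 1 0] by (auto simp: vec_eq_iff)
    then show ?thesis
      using 2 by (auto simp: \<beta>_def)
  next
    case 3
    have xz: "K x z = 0"
      using 3 by (simp add: z_def add_right scale_right g_def \<alpha>_def[symmetric]
          mult.assoc[symmetric])
    then have zx: "K z x = 0"
      using skew[of x z] by simp
    have im: "qcnj \<alpha> = - \<alpha>" "qcnj \<beta> = - \<beta>"
      by (simp_all add: \<alpha>_def \<beta>_def skew)
    define r where "r = norm \<beta> / norm \<alpha>"
    have "r > 0"
      using 3 by (simp add: r_def)
    obtain u where u: "u \<noteq> 0" "\<beta> * u = - (u * (r *\<^sub>R \<alpha>))"
    proof (rule imaginary_conjugate_opposite)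
      show "qcnj (r *\<^sub>R \<alpha>) = - (r *\<^sub>R \<alpha>)" "qcnj \<beta> = - \<beta>" "norm (r *\<^sub>R \<alpha>) = norm \<beta>" "r *\<^sub>R \<alpha> \<noteq> 0"
        using 3 \<open>r > 0\<close> im by (simp_all add: qcnj_scaleR r_def)
    qed
    \<comment> \<open>Now \<open>u\<^sup>* \<beta> u = - |u|\<^sup>2 r \<alpha>\<close>, so the coefficient of \<open>x\<close> is chosen with square \<open>|u|\<^sup>2 r\<close>.\<close>
    define s where "s = norm u * sqrt r"
    define v where "v = z *r u + x *r of_real s"
    have "qcnj u * \<beta> * u = - ((qcnj u * u) * (r *\<^sub>R \<alpha>))"
      by (simp add: mult.assoc u(2))
    also have "\<dots> = - (((norm u)\<^sup>2 * r) *\<^sub>R \<alpha>)"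
      unfolding qcnj_mult_self by (simp add: of_real_def)
    finally have "qcnj u * \<beta> * u = - (((norm u)\<^sup>2 * r) *\<^sub>R \<alpha>)" .
    moreover have "qcnj (of_real s) * \<alpha> * of_real s = (s * s) *\<^sub>R \<alpha>"
      by (simp add: of_real_def qcnj_scaleR)
    moreover have "s * s = (norm u)\<^sup>2 * r"
      using \<open>r > 0\<close> by (simp add: s_def power2_eq_square)
    ultimately have "K v v = 0"
      unfolding v_def combination by (simp add: xz zx \<alpha>_def[symmetric] \<beta>_def[symmetric])
    then show ?thesis
      using z_indep[OF u(1)] v_def by blast
  qed
qed

section \<open>Segments from an isotropic vector\<close>

lemma real_linear_hits_line:
  fixes L :: "'a::euclidean_space \<Rightarrow> 'a"
  assumes "linear L" "b \<noteq> 0"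
  obtains p c where "p \<noteq> 0" "L p = c *\<^sub>R b"
proof (cases "inj L")
  case True
  then obtain p where "L p = b"
    using linear_injective_imp_surjective[OF assms(1)] by (metis surjD)
  then show ?thesis
    using that[of p 1] assms linear_0 by fastforce
next
  case False
  then obtain p where "p \<noteq> 0" "L p = 0"
    using linear_injective_0[OF assms(1)] by blast
  then show ?thesis
    using that[of p 0] by simp
qed

lemma isotropic_segment:
  fixes F :: "quat ^ 'n \<Rightarrow> quat ^ 'n \<Rightarrow> quat" and x y :: "quat ^ 'n"
  assumes "sesquilinear F" and "x \<noteq> 0" and iso: "F x x = 0" and "norm y = 1"
    and s: "0 \<le> s" "s \<le> 1"
  shows "\<exists>z. norm z = 1 \<and> F z z = s *\<^sub>R F y y"
proof (cases "F y y = 0")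
  case True
  then show ?thesis
    using \<open>norm y = 1\<close> by auto
next
  case False
  interpret sesquilinear F by fact
  define b where "b = F y y"
  have "linear (\<lambda>p. qcnj p * F x y + F y x * p)"
    by (rule linearI) (simp_all add: qcnj_add qcnj_scaleR algebra_simps)
  then obtain p c where p: "p \<noteq> 0" "qcnj p * F x y + F y x * p = c *\<^sub>R b"
    using False unfolding b_def by (rule real_linear_hits_line)
  define Z where "Z t = (1 - t) *\<^sub>R (x *r p) + t *\<^sub>R y" for t
  have F_Z: "F (Z t) (Z t) = ((1 - t) * t * c + t\<^sup>2) *\<^sub>R b" for t
  proof -
    have "F (Z t) (Z t) = ((1 - t) * t) *\<^sub>R (qcnj p * F x y + F y x * p) + t\<^sup>2 *\<^sub>R b"
      by (simp add: Z_def add_left add_right scaleR_left scaleR_right scale_left scale_right iso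
          b_def power2_eq_square scaleR_add_right mult.commute)
    then show ?thesis
      by (simp add: p(2) scaleR_add_left)
  qed
  \<comment> \<open>If the path met \<open>0\<close>, then \<open>y\<close> would be a multiple of the isotropic vector \<open>x\<close>.\<close>
  have Z_nonzero: "Z t \<noteq> 0" for t
  proof
    assume Z0: "Z t = 0"
    have "t \<noteq> 0"
      using Z0 p(1) \<open>x \<noteq> 0\<close> by (auto simp: Z_def right_scale_eq_0_iff)
    have "t *\<^sub>R y = x *r (p * of_real (t - 1))"
      using Z0 unfolding right_scale_assoc[symmetric] right_scale_of_real Z_def
      by (simp add: algebra_simps add_eq_0_iff)
    then have "(t * t) *\<^sub>R b = F (x *r (p * of_real (t - 1))) (x *r (p * of_real (t - 1)))"
      unfolding b_def by (metis scaleR_left scaleR_right scaleR_scaleR)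
    also have "\<dots> = 0"
      by (simp add: scale_left scale_right iso)
    finally show False
      using \<open>t \<noteq> 0\<close> False b_def by simp
  qed
  define \<phi> where "\<phi> t = ((1 - t) * t * c + t\<^sup>2) / (norm (Z t))\<^sup>2" for t
  have "continuous_on {0..1} \<phi>"
    unfolding \<phi>_def using Z_nonzero
    by (auto simp: Z_def intro!: continuous_intros)
  moreover have "\<phi> 0 = 0" "\<phi> 1 = 1"
    using \<open>norm y = 1\<close> by (simp_all add: \<phi>_def Z_def)
  ultimately obtain t where t: "\<phi> t = s"
    using IVT'[of \<phi> 0 s 1] s by auto
  define z where "z = inverse (norm (Z t)) *\<^sub>R Z t"
  have "norm z = 1"
    using Z_nonzero[of t] by (simp add: z_def)
  moreover have "F z z = s *\<^sub>R b"
    unfolding z_def scaleR_left scaleR_right F_Z t[symmetric] \<phi>_def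
    by (simp add: power2_eq_square divide_inverse algebra_simps)
  ultimately show ?thesis
    unfolding b_def by blast
qed

section \<open>The numerical range\<close>

lemma real_point_in_star_center:
  fixes A :: "quat ^ 'n ^ 'n"
  assumes "a \<in> \<real>" "a \<in> qnum_range A"
  shows "a \<in> star_center (qnum_range A)"
  unfolding star_center_def
proof (intro CollectI conjI ballI subsetI)
  show "a \<in> qnum_range A" by fact
next
  fix b w
  assume b: "b \<in> qnum_range A" and w: "w \<in> closed_segment a b"
  obtain r where r: "a = of_real r"
    using \<open>a \<in> \<real>\<close> by (rule Reals_cases)
  define G where "G x y = qdot x (A *v y) - r *\<^sub>R qdot x y" for x y
  have sesq: "sesquilinear G"
    unfolding G_def
    by (rule sesquilinear_diff_real_multiple[OF sesquilinear_matrix sesquilinear_qdot])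
  have G_unit: "qdot x (A *v x) = G x x + a" if "norm x = 1" for x
    using that by (simp add: G_def qdot_self r of_real_def)
  obtain x where x: "norm x = 1" "a = qdot x (A *v x)"
    using assms(2) unfolding qnum_range_def by blast
  obtain y where y: "norm y = 1" "b = qdot y (A *v y)"
    using b unfolding qnum_range_def by blast
  obtain s where s: "0 \<le> s" "s \<le> 1" "w = (1 - s) *\<^sub>R a + s *\<^sub>R b"
    using w unfolding closed_segment_def by blast
  have "x \<noteq> 0" "G x x = 0"
    using x G_unit[of x] by auto
  from isotropic_segment[OF sesq this y(1) s(1,2)]
  obtain z where z: "norm z = 1" "G z z = s *\<^sub>R G y y"
    by blast
  have "w = qdot z (A *v z)"
    unfolding G_unit[OF z(1)] z(2) s(3) y(2) G_unit[OF y(1)]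
    by (simp add: algebra_simps)
  then show "w \<in> qnum_range A"
    unfolding qnum_range_def using z(1) by blast
qed

lemma qnum_range_meets_Reals:
  fixes A :: "quat ^ 'n ^ 'n"
  assumes "2 \<le> CARD('n)"
  shows "\<exists>a. a \<in> qnum_range A \<and> a \<in> \<real>"
proof -
  define K where "K x y = qdot x (A *v y) - qcnj (qdot y (A *v x))" for x y
  have sesq: "sesquilinear K"
    unfolding K_def by (rule sesquilinear_skew_part[OF sesquilinear_matrix])
  have skew: "qcnj (K v w) = - K w v" for v w
    by (simp add: K_def qcnj_diff)
  obtain i j :: 'n where "i \<noteq> j"
    using assms card_le_Suc0_iff_eq[of "UNIV :: 'n set"] by fastforce
  have "axis i (1::quat) \<noteq> 0"
    by simp
  moreover have "axis j (1::quat) \<noteq> axis i 1 *r p" for p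
    using \<open>i \<noteq> j\<close> by (auto simp: vec_eq_iff axis_def intro!: exI[of _ j])
  ultimately obtain v where v: "v \<noteq> 0" "K v v = 0"
    using skew_hermitian_isotropic[OF sesq skew] by blast
  define x where "x = inverse (norm v) *\<^sub>R v"
  have "norm x = 1"
    using v(1) by (simp add: x_def)
  have "K x x = 0"
    using v(2) by (simp add: x_def sesquilinear.scaleR_left[OF sesq] sesquilinear.scaleR_right[OF sesq])
  then have "qdot x (A *v x) \<in> \<real>"
    by (intro qcnj_eq_self_imp_Reals) (simp add: K_def)
  then show ?thesis
    unfolding qnum_range_def using \<open>norm x = 1\<close> by blast
qed

theorem theorem3p4:
  fixes A :: "quat ^ 'n ^ 'n"
  shows "(2 \<le> CARD('n) \<longrightarrow> starlike (qnum_range A)) \<and>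
         qnum_range A \<inter> \<real> \<subseteq> star_center (qnum_range A)"
proof (intro conjI impI subsetI)
  assume "2 \<le> CARD('n)"
  then show "starlike (qnum_range A)"
    unfolding starlike_iff_star_center
    using qnum_range_meets_Reals[of A] real_point_in_star_center by blast
next
  fix a
  assume "a \<in> qnum_range A \<inter> \<real>"
  then show "a \<in> star_center (qnum_range A)"
    using real_point_in_star_center by blast
qed

end
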